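(* Let $s=\psi(y)$, $y=y_1y_2\cdots$ with $y_1=a$, be a characteristic Sturmian word beginning with the letter $a$. Then $s$ has the property that for every $n\geq1$ its palindromic prefix of order $n$ has the maximal number of occurrences of $b$ among the palindromic prefixes of order $n$ of characteristic Sturmian words beginning with $a$ (i.e. $|\psi(y_1\cdots y_n)|_b\geq|\psi(v)|_b$ for every word $v$ of length $n$ beginning with $a$) if and only if $s=f=\psi((ab)^\omega)$ or $s=g=\psi(ab^2(ab)^\omega)$.
   Context: Let $\mathcal{A}=\{a,b\}$; $|w|_b$ counts occurrences of $b$ in $w$. $w^{(+)}$ is the shortest palindrome having $w$ as a prefix; $\psi(\varepsilon)=\varepsilon$, $\psi(vx)=(\psi(v)x)^{(+)}$. $\psi$ extends to infinite words by $\psi(y)=\lim_n\psi(y_1\cdots y_n)$ ($y$ is the directive word). Characteristic Sturmian words are exactly the words $\psi(y)$ with both letters occurring infinitely often in $y$; $\psi(y)$ begins with $a$ iff $y_1=a$. The palindromic prefix of order $n$ of $\psi(y)$ is $\psi(y_1\cdots y_n)$. *)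

theory Defs
  imports "HOL-Library.Sublist" "HOL-Library.Omega_Words_Fun"
begin

text \<open>
  Finite words are lists. Infinite words are those of \<^theory>\<open>HOL-Library.Omega_Words_Fun\<close>;
  they are indexed from 0, so the letter written \<open>y\<^sub>1\<close> in the literature is \<open>y 0\<close>, and
  \<open>y\<^sub>1\<cdots>y\<^sub>n\<close> is \<open>y [0 \<rightarrow> n]\<close>.
  The set of letters occurring infinitely often in \<open>y\<close> is \<open>limit y\<close>.
\<close>

datatype letter = A | B

definition palindrome :: "'a list \<Rightarrow> bool" where
  "palindrome w \<longleftrightarrow> rev w = w"

definition is_pal_closure :: "'a list \<Rightarrow> 'a list \<Rightarrow> bool" where
  "is_pal_closure w p \<longleftrightarrow> palindrome p \<and> Sublist.prefix w p \<and>
     (\<forall>q. palindrome q \<and> Sublist.prefix w q \<longrightarrow> length p \<le> length q)"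

definition pal_closure :: "'a list \<Rightarrow> 'a list" where
  "pal_closure w = (THE p. is_pal_closure w p)"

lemma is_pal_closure_exists: "\<exists>p. is_pal_closure w p"
proof -
  let ?P = "\<lambda>p. palindrome p \<and> Sublist.prefix w p"
  have "?P (w @ rev w)" by (simp add: palindrome_def)
  then have "?P (arg_min length ?P) \<and> (\<forall>q. ?P q \<longrightarrow> length (arg_min length ?P) \<le> length q)"
    by (rule arg_min_nat_lemma)
  then show ?thesis unfolding is_pal_closure_def by blast
qed

lemma is_pal_closure_unique:
  assumes "is_pal_closure w p" "is_pal_closure w q"
  shows "p = q"
proof -
  have len: "length p = length q"
    using assms unfolding is_pal_closure_def by (meson le_antisym)
  have "palindrome (w @ rev w)" "Sublist.prefix w (w @ rev w)"
    by (simp_all add: palindrome_def)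
  with assms(1) have "length p \<le> length (w @ rev w)"
    unfolding is_pal_closure_def by blast
  then have short: "length p \<le> 2 * length w" by simp
  have first: "r ! i = w ! i" if "is_pal_closure w r" "i < length w" for r i
    using that by (auto simp: is_pal_closure_def Sublist.prefix_def nth_append)
  have mirror: "r ! i = r ! (length r - Suc i)" if "is_pal_closure w r" "i < length r" for r i
    using that by (metis is_pal_closure_def palindrome_def rev_nth)
  show ?thesis
  proof (rule nth_equalityI[OF len])
    fix i assume i: "i < length p"
    show "p ! i = q ! i"
    proof (cases "i < length w")
      case True
      then show ?thesis using first assms by metis
    next
      case False
      with i short have "length p - Suc i < length w" by linarith
      then show ?thesis
        using first[of p] first[of q] mirror[of p i] mirror[of q i] assms i len by simp
    qed
  qed
qed

lemma is_pal_closure_pal_closure: "is_pal_closure w (pal_closure w)"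
  unfolding pal_closure_def
  using is_pal_closure_exists is_pal_closure_unique by (metis theI)

definition psi :: "'a list \<Rightarrow> 'a list" where
  "psi v = foldl (\<lambda>u x. pal_closure (u @ [x])) [] v"

lemma psi_Nil [simp]: "psi [] = []"
  by (simp add: psi_def)

lemma psi_snoc [simp]: "psi (v @ [x]) = pal_closure (psi v @ [x])"
  by (simp add: psi_def)

text \<open>Convergence of finite words to an infinite word: every prefix is eventually stable.\<close>

definition converges_to :: "(nat \<Rightarrow> 'a list) \<Rightarrow> 'a word \<Rightarrow> bool" where
  "converges_to u s \<longleftrightarrow>
     (\<forall>k. \<forall>\<^sub>F n in sequentially. k \<le> length (u n) \<and> take k (u n) = s [0 \<rightarrow> k])"

definition psi_inf :: "'a word \<Rightarrow> 'a word" where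
  "psi_inf y = (THE s. converges_to (\<lambda>n. psi (y [0 \<rightarrow> n])) s)"

lemma converges_to_unique:
  assumes "converges_to u s" "converges_to u t"
  shows "s = t"
proof
  fix i
  have "\<forall>\<^sub>F n in sequentially. s [0 \<rightarrow> Suc i] = t [0 \<rightarrow> Suc i]"
    using assms[unfolded converges_to_def, THEN spec[of _ "Suc i"]]
    by eventually_elim simp
  then have "s [0 \<rightarrow> Suc i] = t [0 \<rightarrow> Suc i]" by simp
  then show "s i = t i" by (simp add: subsequence_def)
qed

lemma prefix_psi_Suc: "Sublist.prefix (psi (y [0 \<rightarrow> n]) @ [y n]) (psi (y [0 \<rightarrow> Suc n]))"
  using is_pal_closure_pal_closure[of "psi (y [0 \<rightarrow> n]) @ [y n]"]
  by (simp add: subsequence_def is_pal_closure_def)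

lemma prefix_psi_mono:
  assumes "m \<le> n"
  shows "Sublist.prefix (psi (y [0 \<rightarrow> m])) (psi (y [0 \<rightarrow> n]))"
  using assms
proof (induction n rule: dec_induct)
  case (step n)
  then show ?case
    using prefix_psi_Suc[of y n] by (meson append_prefixD prefix_order.trans)
qed simp

lemma length_psi_ge: "n \<le> length (psi (y [0 \<rightarrow> n]))"
proof (induction n)
  case (Suc n)
  then show ?case
    using prefix_length_le[OF prefix_psi_Suc[of y n]] by simp
qed simp

lemma converges_to_psi_inf: "converges_to (\<lambda>n. psi (y [0 \<rightarrow> n])) (psi_inf y)"
proof -
  define s where "s = (\<lambda>i. psi (y [0 \<rightarrow> Suc i]) ! i)"
  have nth: "psi (y [0 \<rightarrow> n]) ! i = s i" if "i < n" for i n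
  proof -
    have "Sublist.prefix (psi (y [0 \<rightarrow> Suc i])) (psi (y [0 \<rightarrow> n]))"
      using that by (intro prefix_psi_mono) simp
    moreover have "i < length (psi (y [0 \<rightarrow> Suc i]))"
      using length_psi_ge[of "Suc i" y] by simp
    ultimately show ?thesis
      by (auto simp: s_def Sublist.prefix_def nth_append)
  qed
  have "k \<le> length (psi (y [0 \<rightarrow> n])) \<and> take k (psi (y [0 \<rightarrow> n])) = s [0 \<rightarrow> k]"
    if "k \<le> n" for k n
  proof -
    have k: "k \<le> length (psi (y [0 \<rightarrow> n]))"
      using that length_psi_ge[of n y] by linarith
    then have "take k (psi (y [0 \<rightarrow> n])) = s [0 \<rightarrow> k]"
      using that by (intro nth_equalityI) (auto simp: nth[unfolded subsequence_def] subsequence_def)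
    with k show ?thesis by simp
  qed
  then have "converges_to (\<lambda>n. psi (y [0 \<rightarrow> n])) s"
    unfolding converges_to_def eventually_sequentially by blast
  then show ?thesis
    unfolding psi_inf_def using converges_to_unique by (metis theI)
qed

end

theory Submission
  imports Defs "HOL-Number_Theory.Fib"
begin

text \<open>
  The palindromic prefixes of \<open>\<psi>(v)\<close> are the words \<open>\<psi>(u)\<close> with \<open>u\<close> a prefix of \<open>v\<close>. Hence the
  longest palindromic suffix of \<open>\<psi>(v)x\<close> is \<open>x\<psi>(v')x\<close>, where \<open>v'x\<close> is the longest prefix of \<open>v\<close>
  ending in \<open>x\<close>, and it is \<open>x\<close> if \<open>x\<close> does not occur in \<open>v\<close>. Let \<open>p\<close> and \<open>q\<close> be the numbers of
  letters \<open>b\<close> gained when \<open>v\<close> is extended by \<open>a\<close> and by \<open>b\<close>. Extending \<open>v\<close> by \<open>a\<close> turns \<open>(p, q)\<close>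
  into \<open>(p, p + q)\<close>, extending it by \<open>b\<close> turns it into \<open>(p + q, q)\<close>; for \<open>v = a\<close> the pair is
  \<open>(0, 1)\<close>, and \<open>|\<psi>(v)|\<^sub>b = p + q - 1\<close> for all \<open>v\<close> beginning with \<open>a\<close>. So \<open>p + q\<close> is at most the
  Fibonacci number \<open>F(n+1)\<close> for \<open>|v| = n\<close>. Equality for all \<open>n\<close> forces the second letter to be
  \<open>b\<close>, which leads to the symmetric pair \<open>(1, 1)\<close>; so the third letter is free, and from then on
  the letters must alternate.
\<close>

section \<open>Palindromic prefixes and palindromic closure\<close>

lemma palindrome_psi: "palindrome (psi v)"
  by (cases v rule: rev_cases)
    (use is_pal_closure_pal_closure in \<open>auto simp: is_pal_closure_def palindrome_def\<close>)

lemma rev_psi [simp]: "rev (psi v) = psi v"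
  using palindrome_psi by (simp add: palindrome_def)

lemma prefix_psi_snoc: "Sublist.prefix (psi v @ [x]) (psi (v @ [x]))"
  using is_pal_closure_pal_closure[of "psi v @ [x]"] by (simp add: is_pal_closure_def)

lemma length_psi_snoc_le:
  assumes "palindrome p" "Sublist.prefix (psi v @ [x]) p"
  shows "length (psi (v @ [x])) \<le> length p"
  using is_pal_closure_pal_closure[of "psi v @ [x]"] assms by (simp add: is_pal_closure_def)

lemma prefix_psi:
  assumes "Sublist.prefix u v"
  shows "Sublist.prefix (psi u) (psi v)"
  using assms
proof (induction v rule: rev_induct)
  case (snoc x v)
  have step: "Sublist.prefix (psi v) (psi (v @ [x]))"
    by (rule append_prefixD[OF prefix_psi_snoc])
  from snoc.prems consider "u = v @ [x]" | "Sublist.prefix u v" by auto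
  then show ?case
  proof cases
    case 1
    then show ?thesis by (simp del: psi_snoc)
  next
    case 2
    then show ?thesis by (rule prefix_order.trans[OF snoc.IH step])
  qed
qed simp

text \<open>A palindromic prefix of \<open>psi (v @ [x])\<close> longer than \<open>psi v\<close>
  extends \<open>psi v @ [x]\<close>, so minimality of the closure makes it the whole word. Shorter
  ones fall to the induction hypothesis.\<close>

lemma palindromic_prefix_psi:
  assumes "palindrome p" "Sublist.prefix p (psi v)"
  shows "\<exists>u. Sublist.prefix u v \<and> p = psi u"
  using assms(2)
proof (induction v rule: rev_induct)
  case (snoc x v)
  show ?case
  proof (cases "length p \<le> length (psi v)")
    case True
    then have "Sublist.prefix p (psi v)"
      using prefix_length_prefix[OF snoc.prems append_prefixD[OF prefix_psi_snoc]] by blast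
    then obtain u where "Sublist.prefix u v" "p = psi u" using snoc.IH by blast
    then show ?thesis by auto
  next
    case False
    then have "Sublist.prefix (psi v @ [x]) p"
      using prefix_length_prefix[OF prefix_psi_snoc snoc.prems] by simp
    then have "length (psi (v @ [x])) \<le> length p"
      using assms(1) by (rule length_psi_snoc_le[rotated])
    then have "p = psi (v @ [x])"
      using snoc.prems by (auto elim: prefixE simp del: psi_snoc)
    then show ?thesis by blast
  qed
qed simp

text \<open>
  If \<open>psi (v @ [x])\<close> is shorter than \<open>psi v @ [x] @ psi v\<close>, the two occurrences of \<open>psi v\<close> in it, as
  prefix and as suffix, overlap in a palindrome.
\<close>
lemma psi_snoc_short_tail:
  assumes eq: "psi (v @ [x]) = psi v @ x # t" and short: "length t < length (psi v)"
  obtains u where "Sublist.prefix (u @ [x]) v" "length (psi v) = Suc (length (psi u) + length t)"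
proof -
  have mirror: "psi v @ x # t = rev t @ x # psi v"
    using eq rev_psi[of "v @ [x]"] by (simp del: psi_snoc)
  then have "Sublist.prefix (rev t @ [x]) (psi v @ x # t)" by simp
  then have "Sublist.prefix (rev t @ [x]) (psi v)"
    by (rule prefix_length_prefix) (use short in simp_all)
  then obtain z where z: "psi v = rev t @ x # z" by (auto elim: prefixE)
  have "(rev t @ x # z) @ x # t = rev t @ x # psi v"
    using mirror by (simp only: z[symmetric])
  then have z': "psi v = z @ x # t" by simp
  have "rev t @ x # z = rev (z @ x # t)"
    by (simp only: z'[symmetric] z[symmetric] rev_psi)
  then have "palindrome z" by (simp add: palindrome_def)
  then obtain u where u: "Sublist.prefix u v" "z = psi u"
    using palindromic_prefix_psi[of z v] z' by auto
  have "u \<noteq> v" using u(2) z' by auto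
  then obtain w s where "v = u @ w # s"
    using u(1) by (metis append_Nil2 neq_Nil_conv prefixE)
  then have w: "Sublist.prefix (u @ [w]) v" by simp
  have "Sublist.prefix (psi u @ [w]) (psi v)"
    using prefix_psi_snoc prefix_psi[OF w] by (rule prefix_order.trans)
  \<comment> \<open>In \<open>psi v\<close> the prefix \<open>psi u\<close> is followed by the next
    directive letter \<open>w\<close>, and by \<open>z'\<close> it is followed by
    \<open>x\<close>.\<close>
  then have "w = x" using z' u(2) by simp
  then show thesis using that w z' u(2) by simp
qed

text \<open>A shorter closure would yield an earlier \<open>x\<close> in \<open>v\<close>; a longer
  one is excluded by the palindrome \<open>psi v @ x # psi v\<close>.\<close>

lemma psi_snoc_fresh:
  assumes "x \<notin> set v"
  shows "psi (v @ [x]) = psi v @ x # psi v"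
proof -
  obtain t where t: "psi (v @ [x]) = psi v @ x # t"
    using prefix_psi_snoc[of v x] by (auto simp del: psi_snoc elim: prefixE)
  have "\<not> length t < length (psi v)"
  proof
    assume "length t < length (psi v)"
    with t obtain u where "Sublist.prefix (u @ [x]) v" by (rule psi_snoc_short_tail)
    then show False using assms by (auto elim: prefixE)
  qed
  moreover have "length t \<le> length (psi v)"
    using length_psi_snoc_le[of "psi v @ x # psi v" v x] t
    by (simp add: palindrome_def del: psi_snoc)
  ultimately have len: "length (rev t) = length (psi v)" by simp
  have "rev t @ x # psi v = psi v @ x # t"
    using t rev_psi[of "v @ [x]"] by (simp del: psi_snoc)
  then have "rev t = psi v \<and> x # psi v = x # t"
    by (rule iffD1[OF append_eq_append_conv, rotated]) (rule disjI1[OF len])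
  then show ?thesis using t by simp
qed

text \<open>Since \<open>psi v\<close> is a palindrome, so is \<open>psi v @ x # r\<close>, which
  bounds the closure from above. A shorter closure would overlap in \<open>psi u\<close> with
  \<open>psi u\<close> longer than \<open>psi v'\<close>, but \<open>v' @ [x]\<close> is the longest
  prefix of \<open>v\<close> ending in \<open>x\<close>.\<close>

lemma psi_snoc_last_occurrence:
  assumes v: "v = v' @ x # v''" and x: "x \<notin> set v''" and r: "psi v = psi v' @ x # r"
  shows "psi (v @ [x]) = psi v @ x # r"
proof -
  obtain t where t: "psi (v @ [x]) = psi v @ x # t"
    using prefix_psi_snoc[of v x] by (auto simp del: psi_snoc elim: prefixE)
  have "psi v = rev (psi v' @ x # r)" by (simp only: r[symmetric] rev_psi)
  then have mirror: "psi v = rev r @ x # psi v'" by simp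
  have "rev (psi v @ x # r) = rev r @ x # (psi v' @ x # r)" by (simp add: r[symmetric])
  also have "\<dots> = psi v @ x # r" by (simp add: mirror)
  finally have "palindrome (psi v @ x # r)" by (simp only: palindrome_def)
  then have le: "length t \<le> length r"
    using length_psi_snoc_le[of "psi v @ x # r" v x] t by (simp del: psi_snoc)
  then have "length t < length (psi v)" using r by simp
  with t obtain u where u: "Sublist.prefix (u @ [x]) v"
      "length (psi v) = Suc (length (psi u) + length t)" by (rule psi_snoc_short_tail)
  have "length u \<le> length v'"
  proof (rule ccontr)
    assume long: "\<not> length u \<le> length v'"
    have "Sublist.prefix (v' @ [x]) u"
      by (rule prefix_length_prefix[of _ v]) (use long v u(1) append_prefixD in \<open>auto\<close>)
    then obtain w where "u = v' @ x # w" by (auto elim: prefixE)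
    then have "Sublist.prefix (w @ [x]) v''" using u(1) v by simp
    then show False using x by (auto elim: prefixE)
  qed
  then have "Sublist.prefix u v'"
    using prefix_length_prefix[OF append_prefixD[OF u(1)], of v'] v by simp
  then have "length (psi u) \<le> length (psi v')" by (intro prefix_length_le prefix_psi)
  then have len: "length (rev t) = length (rev r)" using u(2) r le by simp
  have "rev t @ x # psi v = psi v @ x # t"
    using t rev_psi[of "v @ [x]"] by (simp del: psi_snoc)
  also have "\<dots> = rev r @ x # psi v' @ x # t" by (simp add: mirror)
  finally have "rev t = rev r \<and> x # psi v = x # psi v' @ x # t"
    by (rule iffD1[OF append_eq_append_conv, rotated]) (rule disjI1[OF len])
  then show ?thesis using t by simp
qed

section \<open>Increments of letter counts\<close>

definition psi_incr :: "'a \<Rightarrow> 'a list \<Rightarrow> 'a \<Rightarrow> int" where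
  "psi_incr z v x = int (count_list (psi (v @ [x])) z) - int (count_list (psi v) z)"

lemma psi_incr_fresh:
  "x \<notin> set v \<Longrightarrow> psi_incr z v x = int (count_list (psi v) z) + (if x = z then 1 else 0)"
  by (simp add: psi_incr_def psi_snoc_fresh del: psi_snoc)

lemma psi_incr_last_occurrence:
  assumes "v = v' @ x # v''" "x \<notin> set v''"
  shows "psi_incr z v x = int (count_list (psi v) z) - int (count_list (psi v') z)"
proof -
  have "Sublist.prefix (psi v' @ [x]) (psi v)"
    using prefix_psi_snoc
  proof (rule prefix_order.trans)
    show "Sublist.prefix (psi (v' @ [x])) (psi v)"
      by (rule prefix_psi) (simp add: assms(1))
  qed
  then obtain r where "psi v = psi v' @ x # r" by (auto elim: prefixE)
  with psi_snoc_last_occurrence[OF assms this] show ?thesis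
    by (simp add: psi_incr_def del: psi_snoc)
qed

text \<open>The last \<open>x\<close> of \<open>v @ [x]\<close> is preceded by \<open>v\<close>, so
  the gain is again the count in \<open>psi (v @ [x])\<close> minus that in
  \<open>psi v\<close>.\<close>

lemma psi_incr_snoc_same: "psi_incr z (v @ [x]) x = psi_incr z v x"
  using psi_incr_last_occurrence[of "v @ [x]" v x "[]" z] by (simp add: psi_incr_def del: psi_snoc)

text \<open>Appending \<open>x\<close> keeps the prefix before the last \<open>y\<close> and raises
  only the count from which its count is subtracted. If \<open>y\<close> is new, nothing is
  subtracted and the same growth results.\<close>

lemma psi_incr_snoc_other:
  assumes "x \<noteq> y"
  shows "psi_incr z (v @ [x]) y = psi_incr z v x + psi_incr z v y"
proof (cases "y \<in> set v")
  case True
  then obtain v' v'' where v: "v = v' @ y # v''" "y \<notin> set v''" by (meson split_list_last)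
  show ?thesis
    using psi_incr_last_occurrence[of "v @ [x]" v' y "v'' @ [x]" z]
      psi_incr_last_occurrence[OF v, of z] v assms
    by (simp add: psi_incr_def del: psi_snoc)
next
  case False
  then show ?thesis
    using assms by (simp add: psi_incr_fresh psi_incr_def[of z v x] del: psi_snoc)
qed

lemma psi_incr_nonneg: "0 \<le> psi_incr z v x"
proof -
  obtain t where "psi (v @ [x]) = psi v @ x # t"
    using prefix_psi_snoc[of v x] by (auto simp del: psi_snoc elim: prefixE)
  then show ?thesis by (simp add: psi_incr_def del: psi_snoc)
qed

section \<open>Words over two letters\<close>

lemma psi_singleton: "psi [x] = [x]"
  using psi_snoc_fresh[of x "[]"] by simp

lemma psi_incr_singleton: "psi_incr B [A] A = 0" "psi_incr B [A] B = 1"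
  using psi_incr_snoc_same[of B "[]" A] psi_incr_fresh[of B "[A]" B] psi_incr_fresh[of A "[]" B]
  by (simp_all add: psi_singleton)

text \<open>Appending \<open>x\<close> adds the increment of \<open>x\<close> both to the count and,
  through the other letter, to the sum of increments.\<close>

lemma count_psi_eq_incr:
  "int (count_list (psi (A # w)) B) + 1 = psi_incr B (A # w) A + psi_incr B (A # w) B"
proof (induction w rule: rev_induct)
  case Nil
  then show ?case by (simp add: psi_singleton psi_incr_singleton)
next
  case (snoc x w)
  have "int (count_list (psi ((A # w) @ [x])) B)
      = int (count_list (psi (A # w)) B) + psi_incr B (A # w) x"
    by (simp add: psi_incr_def)
  then show ?case
    using snoc psi_incr_snoc_same[of B "A # w" x] psi_incr_snoc_other[of A B B "A # w"]
      psi_incr_snoc_other[of B A B "A # w"]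
    by (cases x) (simp_all del: psi_snoc)
qed

text \<open>The bounds support each other: the changed increment becomes the old sum, the unchanged
  one is at most the old sum by nonnegativity, and the new sum is the old sum plus one old
  increment.\<close>

lemma psi_incr_le_fib:
  "psi_incr B (A # w) A \<le> int (fib (Suc (length w))) \<and>
   psi_incr B (A # w) B \<le> int (fib (Suc (length w))) \<and>
   psi_incr B (A # w) A + psi_incr B (A # w) B \<le> int (fib (Suc (Suc (length w))))"
proof (induction w rule: rev_induct)
  case Nil
  then show ?case by (simp add: psi_incr_singleton)
next
  case (snoc x w)
  then show ?case
    using psi_incr_snoc_same[of B "A # w" x] psi_incr_snoc_other[of A B B "A # w"]
      psi_incr_snoc_other[of B A B "A # w"] psi_incr_nonneg[of B "A # w" A]
      psi_incr_nonneg[of B "A # w" B]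
    by (cases x) simp_all
qed

lemma count_psi_less_fib: "count_list (psi (A # w)) B < fib (Suc (Suc (length w)))"
  using psi_incr_le_fib[of w] count_psi_eq_incr[of w] by linarith

text \<open>Equality in the strict bound \<open>count_psi_less_fib\<close> at every order.\<close>

definition fib_optimal :: "letter word \<Rightarrow> bool" where
  "fib_optimal y \<longleftrightarrow> (\<forall>n\<ge>1. Suc (count_list (psi (y [0 \<rightarrow> n])) B) = fib (Suc n))"

lemma subsequence_zero_Suc: "y [0 \<rightarrow> Suc n] = y [0 \<rightarrow> n] @ [y n]"
  by (simp add: subsequence_def)

lemma subsequence_zero_Cons: "n \<ge> 1 \<Longrightarrow> \<exists>w. y [0 \<rightarrow> n] = y 0 # w \<and> length w = n - 1"
  by (cases n) (simp_all add: subsequence_def upt_conv_Cons del: upt_Suc)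

lemma count_psi_Suc:
  "int (count_list (psi (y [0 \<rightarrow> Suc n])) z)
    = int (count_list (psi (y [0 \<rightarrow> n])) z) + psi_incr z (y [0 \<rightarrow> n]) (y n)"
  by (simp add: subsequence_zero_Suc psi_incr_def del: psi_snoc)

text \<open>Optimal counts make the increments consecutive Fibonacci numbers, whereas a repeated
  letter repeats its increment. As \<open>fib n = fib (n - 1)\<close> fails for
  \<open>n \<ge> 3\<close> but holds for \<open>n = 2\<close>, the letter \<open>y 2\<close> stays
  free.\<close>

lemma alternating_if_fib_optimal:
  assumes "fib_optimal y" "y 0 = A"
  shows "y 1 = B" "n \<ge> 3 \<Longrightarrow> y n \<noteq> y (n - 1)"
proof -
  have val: "int (count_list (psi (y [0 \<rightarrow> n])) B) = int (fib (Suc n)) - 1" if "n \<ge> 1" for n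
    using assms(1) that unfolding fib_optimal_def by (metis diff_add_cancel add_diff_cancel_left' of_nat_Suc)
  show "y 1 = B"
  proof (rule ccontr)
    assume "y 1 \<noteq> B"
    then have "y 1 = A" by (cases "y 1") auto
    then show False
      using val[of 1] val[of 2] count_psi_Suc[of y 1 B] assms(2) psi_incr_singleton
      by (simp add: subsequence_def numeral_2_eq_2 del: psi_snoc)
  qed
  show "y n \<noteq> y (n - 1)" if three: "n \<ge> 3"
  proof
    assume eq: "y n = y (n - 1)"
    obtain m where m: "n = Suc m" "m \<ge> 2" using three by (cases n) auto
    have "psi_incr B (y [0 \<rightarrow> n]) (y n) = psi_incr B (y [0 \<rightarrow> m]) (y m)"
      using eq m by (simp add: subsequence_zero_Suc psi_incr_snoc_same)
    then have "int (fib (Suc (Suc n))) - int (fib (Suc n)) = int (fib (Suc n)) - int (fib n)"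
      using val[of m] val[of n] val[of "Suc n"] count_psi_Suc[of y n B] count_psi_Suc[of y m B] m
      by (simp del: fib.simps)
    moreover obtain k where "m = Suc (Suc k)"
      using m by (metis add_2_eq_Suc less_eqE)
    ultimately show False using m fib_neq_0_nat[of "Suc k"] by simp
  qed
qed

lemma fib_optimal_if_alternating:
  assumes y: "y 0 = A" "y 1 = B" and alt: "\<And>n. n \<ge> 3 \<Longrightarrow> y n \<noteq> y (n - 1)"
  shows "fib_optimal y"
proof -
  have two: "psi_incr B (y [0 \<rightarrow> 2]) x = 1" for x
  proof -
    have "y [0 \<rightarrow> 2] = [A] @ [B]" using y by (simp add: subsequence_def numeral_2_eq_2)
    then show ?thesis
      using psi_incr_snoc_other[of B A B "[A]"] psi_incr_snoc_same[of B "[A]" B] psi_incr_singleton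
      by (cases x) simp_all
  qed
  \<comment> \<open>The letter just read has the smaller increment, and alternation always picks the
    larger one next. The induction starts at 3 because \<open>y 2\<close> is arbitrary; the pair
    \<open>(1, 1)\<close> before it is symmetric.\<close>
  have incr: "psi_incr B (y [0 \<rightarrow> n]) x = int (fib (if x = y (n - 1) then n - 1 else n))"
    if "n \<ge> 3" for n x
    using that
  proof (induction n arbitrary: x rule: dec_induct)
    case base
    have "y [0 \<rightarrow> 3] = y [0 \<rightarrow> 2] @ [y 2]"
      using subsequence_zero_Suc[of y 2] by (simp add: numeral_3_eq_3)
    then show ?case
      using two psi_incr_snoc_same[of B "y [0 \<rightarrow> 2]" "y 2"]
        psi_incr_snoc_other[of "y 2" x B "y [0 \<rightarrow> 2]"]
      by (auto simp: numeral_3_eq_3 numeral_2_eq_2)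
  next
    case (step n)
    obtain m where m: "n = Suc m" using step.hyps by (cases n) auto
    have ne: "y n \<noteq> y m" using alt[of n] step.hyps m by simp
    show ?case
    proof (cases "x = y n")
      case True
      then have "psi_incr B (y [0 \<rightarrow> Suc n]) x = psi_incr B (y [0 \<rightarrow> n]) x"
        by (simp only: subsequence_zero_Suc psi_incr_snoc_same)
      also have "\<dots> = int (fib n)" using step.IH[of x] True ne m by simp
      finally show ?thesis using True by simp
    next
      case False
      then have "x = y m" using ne by (metis (full_types) letter.exhaust)
      have "psi_incr B (y [0 \<rightarrow> Suc n]) x
          = psi_incr B (y [0 \<rightarrow> n]) (y n) + psi_incr B (y [0 \<rightarrow> n]) x"
        by (simp only: subsequence_zero_Suc psi_incr_snoc_other[OF not_sym[OF False]])
      also have "\<dots> = int (fib n) + int (fib m)"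
        using step.IH[of x] step.IH[of "y n"] \<open>x = y m\<close> ne m by simp
      finally show ?thesis using False m by simp
    qed
  qed
  have sum: "psi_incr B (y [0 \<rightarrow> n]) A + psi_incr B (y [0 \<rightarrow> n]) B = int (fib (Suc n))"
    if "n \<ge> 1" for n
  proof -
    consider "n = 1" | "n = 2" | "n \<ge> 3" using \<open>n \<ge> 1\<close> by linarith
    then show ?thesis
    proof cases
      case 1
      then show ?thesis using y psi_incr_singleton by (simp add: subsequence_def)
    next
      case 2
      then show ?thesis using two by (simp add: numeral_2_eq_2)
    next
      case 3
      then obtain m where "n = Suc m" by (cases n) auto
      then show ?thesis using incr[OF 3] by (cases "y m") simp_all
    qed
  qed
  show ?thesis
    unfolding fib_optimal_def
  proof (intro allI impI)
    fix n :: nat assume n: "n \<ge> 1"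
    obtain w where "y [0 \<rightarrow> n] = A # w" using subsequence_zero_Cons[OF n, of y] y by auto
    then show "Suc (count_list (psi (y [0 \<rightarrow> n])) B) = fib (Suc n)"
      using count_psi_eq_incr[of w] sum[OF n] by simp
  qed
qed

section \<open>The two alternating directive words\<close>

lemma iter_AB_nth: "([A, B]\<^sup>\<omega>) n = (if even n then A else B)"
  by (simp add: iter_def mod2_eq_if flip: numeral_2_eq_2)

lemma ABB_iter_AB_nth:
  "([A, B, B] \<frown> [A, B]\<^sup>\<omega>) 0 = A"
  "([A, B, B] \<frown> [A, B]\<^sup>\<omega>) (Suc 0) = B"
  "([A, B, B] \<frown> [A, B]\<^sup>\<omega>) (Suc (Suc n)) = (if even n then B else A)"
proof -
  show "([A, B, B] \<frown> [A, B]\<^sup>\<omega>) (Suc (Suc n)) = (if even n then B else A)"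
    by (cases n) (simp_all add: conc_def iter_AB_nth)
qed (simp_all add: conc_def)

text \<open>Alternation from index 3 on lets \<open>y 2\<close> determine the rest: \<open>A\<close>
  gives the first word, \<open>B\<close> the second.\<close>

lemma alternating_cases:
  fixes y :: "letter word"
  assumes y: "y 0 = A" "y 1 = B"
  shows "(\<forall>n\<ge>3. y n \<noteq> y (n - 1)) \<longleftrightarrow> y = [A, B]\<^sup>\<omega> \<or> y = [A, B, B] \<frown> [A, B]\<^sup>\<omega>"
proof
  assume alt: "\<forall>n\<ge>3. y n \<noteq> y (n - 1)"
  have tail: "y (Suc (Suc n)) = (if even n then y 2 else if y 2 = A then B else A)" for n
  proof (induction n)
    case (Suc n)
    have "y (Suc (Suc (Suc n))) \<noteq> y (Suc (Suc n))"
      using alt[rule_format, of "Suc (Suc (Suc n))"] by simp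
    with Suc show ?case
      by (cases "y (Suc (Suc (Suc n)))"; cases "y 2"; cases "even n") simp_all
  qed (simp add: numeral_2_eq_2)
  show "y = [A, B]\<^sup>\<omega> \<or> y = [A, B, B] \<frown> [A, B]\<^sup>\<omega>"
  proof (cases "y 2")
    case A
    have "y n = ([A, B]\<^sup>\<omega>) n" for n
    proof (cases n)
      case (Suc m)
      then show ?thesis using y tail A by (cases m) (simp_all add: iter_AB_nth)
    qed (simp add: y iter_AB_nth)
    then show ?thesis by blast
  next
    case B
    have "y n = ([A, B, B] \<frown> [A, B]\<^sup>\<omega>) n" for n
    proof (cases n)
      case (Suc m)
      show ?thesis
      proof (cases m)
        case 0
        then show ?thesis using y Suc by (simp add: ABB_iter_AB_nth)
      next
        case (Suc k)
        show ?thesis unfolding \<open>n = Suc m\<close> Suc ABB_iter_AB_nth tail B by simp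
      qed
    qed (simp add: y ABB_iter_AB_nth)
    then show ?thesis by blast
  qed
next
  assume y: "y = [A, B]\<^sup>\<omega> \<or> y = [A, B, B] \<frown> [A, B]\<^sup>\<omega>"
  show "\<forall>n\<ge>3. y n \<noteq> y (n - 1)"
  proof (intro allI impI)
    fix n :: nat assume "n \<ge> 3"
    then have "n = Suc (Suc (Suc (n - 3)))" by simp
    then obtain k where k: "n = Suc (Suc (Suc k))" by blast
    from y show "y n \<noteq> y (n - 1)"
      using ABB_iter_AB_nth(3)[of k] ABB_iter_AB_nth(3)[of "Suc k"]
      by (elim disjE) (simp_all add: k iter_AB_nth)
  qed
qed

lemma fib_optimal_iff:
  assumes "y 0 = A"
  shows "fib_optimal y \<longleftrightarrow> y = [A, B]\<^sup>\<omega> \<or> y = [A, B, B] \<frown> [A, B]\<^sup>\<omega>"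
proof (cases "y 1 = B")
  case True
  then show ?thesis
    using alternating_if_fib_optimal(2)[of y] fib_optimal_if_alternating[of y]
      alternating_cases[of y] assms by blast
next
  case False
  moreover have "([A, B]\<^sup>\<omega>) 1 = B" "([A, B, B] \<frown> [A, B]\<^sup>\<omega>) 1 = B"
    by (simp_all add: iter_def conc_def)
  ultimately show ?thesis using alternating_if_fib_optimal(1) assms by metis
qed

section \<open>Injectivity of the directive word\<close>

lemma psi_prefix_psi_inf:
  "psi (y [0 \<rightarrow> n]) = psi_inf y [0 \<rightarrow> length (psi (y [0 \<rightarrow> n]))]"
proof -
  let ?k = "length (psi (y [0 \<rightarrow> n]))"
  have "\<forall>\<^sub>F m in sequentially. take ?k (psi (y [0 \<rightarrow> m])) = psi_inf y [0 \<rightarrow> ?k]"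
    using converges_to_psi_inf[of y, unfolded converges_to_def, THEN spec, of ?k]
    by eventually_elim simp
  then have "\<forall>\<^sub>F m in sequentially. psi (y [0 \<rightarrow> n]) = psi_inf y [0 \<rightarrow> ?k]"
    using eventually_ge_at_top[of n]
  proof eventually_elim
    case (elim m)
    then show ?case using prefix_psi_mono[of n m y] by (metis append_eq_conv_conj prefix_def)
  qed
  then show ?thesis by simp
qed

text \<open>The letter after each palindromic prefix reveals the next directive letter, so
  \<open>y\<close> can be recovered recursively from \<open>psi_inf y\<close>.\<close>

lemma psi_inf_nth_length: "psi_inf y (length (psi (y [0 \<rightarrow> n]))) = y n"
proof -
  let ?k = "length (psi (y [0 \<rightarrow> n]))"
  obtain t where t: "psi (y [0 \<rightarrow> Suc n]) = psi (y [0 \<rightarrow> n]) @ y n # t"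
    using prefix_psi_Suc[of y n] by (auto elim: prefixE)
  then have "psi (y [0 \<rightarrow> Suc n]) ! ?k = y n" by simp
  moreover have "?k < length (psi (y [0 \<rightarrow> Suc n]))" using t by simp
  ultimately show ?thesis
    using psi_prefix_psi_inf[of y "Suc n"] by (metis add_0 subsequence_nth diff_zero)
qed

lemma inj_psi_inf: "inj psi_inf"
proof (rule injI, rule ext)
  fix y z :: "'a word" and n :: nat
  assume eq: "psi_inf y = psi_inf z"
  show "y n = z n"
  proof (induction n rule: less_induct)
    case (less n)
    then have "y [0 \<rightarrow> n] = z [0 \<rightarrow> n]" by (simp add: subsequence_def)
    then show ?case using eq psi_inf_nth_length[of y n] psi_inf_nth_length[of z n] by simp
  qed
qed

section \<open>Maximality as attainment of the Fibonacci bound\<close>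

lemma maximal_iff_fib_optimal:
  assumes "y 0 = A"
  shows "(\<forall>n\<ge>1. \<forall>v. length v = n \<and> hd v = A \<longrightarrow>
             count_list (psi v) B \<le> count_list (psi (y [0 \<rightarrow> n])) B) \<longleftrightarrow> fib_optimal y"
    (is "?max \<longleftrightarrow> _")
proof
  assume max: ?max
  \<comment> \<open>This word attains the bound at every order, so a maximal \<open>y\<close> must
    attain it too.\<close>
  let ?f = "[A, B]\<^sup>\<omega>"
  have f0: "?f 0 = A" by (simp add: iter_def)
  then have f: "fib_optimal ?f" by (simp add: fib_optimal_iff)
  show "fib_optimal y"
    unfolding fib_optimal_def
  proof (intro allI impI)
    fix n :: nat assume n: "n \<ge> 1"
    obtain w where w: "y [0 \<rightarrow> n] = A # w" "length w = n - 1"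
      using subsequence_zero_Cons[OF n, of y] assms by auto
    obtain w' where w': "?f [0 \<rightarrow> n] = A # w'" "length w' = n - 1"
      using subsequence_zero_Cons[OF n, of ?f] f0 by auto
    have "length (?f [0 \<rightarrow> n]) = n \<and> hd (?f [0 \<rightarrow> n]) = A" using w' n by simp
    then have "count_list (psi (?f [0 \<rightarrow> n])) B \<le> count_list (psi (y [0 \<rightarrow> n])) B"
      using max n by blast
    moreover have "Suc (count_list (psi (?f [0 \<rightarrow> n])) B) = fib (Suc n)"
      using f n by (simp add: fib_optimal_def)
    moreover have "count_list (psi (y [0 \<rightarrow> n])) B < fib (Suc n)"
      using count_psi_less_fib[of w] w n by simp
    ultimately show "Suc (count_list (psi (y [0 \<rightarrow> n])) B) = fib (Suc n)" by linarith
  qed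
next
  assume opt: "fib_optimal y"
  show ?max
  proof (intro allI impI)
    fix n :: nat and v assume n: "n \<ge> 1" and v: "length v = n \<and> hd v = A"
    then obtain w where w: "v = A # w" by (cases v) auto
    have "count_list (psi v) B < fib (Suc n)" using count_psi_less_fib[of w] v w by auto
    also have "\<dots> = Suc (count_list (psi (y [0 \<rightarrow> n])) B)"
      using opt n by (simp add: fib_optimal_def)
    finally show "count_list (psi v) B \<le> count_list (psi (y [0 \<rightarrow> n])) B" by simp
  qed
qed

theorem theorem4p9:
  fixes s y :: "letter word"
  assumes "limit y = {A, B}" and "y 0 = A" and "s = psi_inf y"
  shows "(\<forall>n\<ge>1. \<forall>v. length v = n \<and> hd v = A \<longrightarrow>
             count_list (psi v) B \<le> count_list (psi (y [0 \<rightarrow> n])) B)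
         \<longleftrightarrow> s = psi_inf ([A, B]\<^sup>\<omega>) \<or> s = psi_inf ([A, B, B] \<frown> [A, B]\<^sup>\<omega>)"
  unfolding maximal_iff_fib_optimal[of y, OF assms(2)] fib_optimal_iff[of y, OF assms(2)] assms(3)
  \<comment> \<open>Injectivity turns equality of Sturmian words into equality of directive
    words.\<close>
  by (simp only: inj_eq[OF inj_psi_inf])

end
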